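(* Let $G$ be a weighted digraph whose weights are induced by $\{\omega_i(G)\}_{i\in V(G)}$, and suppose $G$ contains a weighted biclique $Q$, with parts $Q^{(1)}$ and $Q^{(2)}$, as a weighted sub-digraph. Let $G^*$ be the weighted digraph obtained from $G$ by replacing $Q$ with the weighted directed star $K^{\omega}_{1,|Q|}$ with centre $o$. Set $\omega(Q)=\sum_{v\in Q^{(2)}}\omega_v(G)$ and assume $\omega(Q)\ne 0$. Then $$t_u(G^*,\omega)=\omega(Q)\,t_u(G,\omega)\quad\text{for any } u\in V(G),$$ $$t_o(G^*,\omega)=\sum_{v\in Q^{(1)}}t_v(G^*,\omega)=\omega(Q)\sum_{v\in Q^{(1)}}t_v(G,\omega).$$
   Context: Digraphs are finite, with nonempty vertex set, without loops or multiple edges (both $(u,v)$ and $(v,u)$ may be edges); $(u,v)$ is directed from $u$ to $v$. In a weighted digraph $G$ each edge $e=(i,j)$ has a weight $\omega_e(G)=\omega_{ij}(G)$; weights are indeterminates, or values of them, regarded as elements of a field. The weights of $G$ are induced by $\{\omega_i(G)\}_{i\in V(G)}$ if every edge $(u,v)$ has weight $\omega_{uv}(G)=\omega_v(G)$. An oriented spanning tree of a digraph is a subtree containing all its vertices, in which one vertex, the root, has outdegree $0$ and every other vertex has outdegree $1$. $\mathcal{T}_v(G)$ is the set of oriented spanning trees of $G$ with root $v$, and $t_v(G,\omega)=\sum_{T\in\mathcal{T}_v(G)}\prod_{e\in E(T)}\omega_e(G)$, computed with the edge weights of the weighted digraph in question. A biclique is a complete bipartite digraph $Q$ whose vertices are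 partitioned into two (nonempty, disjoint) parts $Q^{(1)}$ and $Q^{(2)}$ with $E(Q)=\{(i,j): i\in Q^{(1)},\ j\in Q^{(2)}\}$. The sub-digraph need not be induced, and its edges carry the weights they have in $G$. The weighted directed star $K^{\omega}_{1,|Q|}$ has vertex set $\{o\}\cup Q^{(1)}\cup Q^{(2)}$, where $o\notin V(G)$ is a new vertex, and edge set $\{(u,o):u\in Q^{(1)}\}\cup\{(o,v):v\in Q^{(2)}\}$, with weights $\omega_{uo}=\sum_{v\in Q^{(2)}}\omega_v(G)$ for $u\in Q^{(1)}$ and $\omega_{ov}=\omega_v(G)$ for $v\in Q^{(2)}$. Replacing $Q$ by this star means deleting the edges of $Q$ from $G$ and adding the vertex $o$ and the weighted edges of the star; all other edges of $G$ and their weights are unchanged. *)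

theory Defs
  imports "Graph_Theory.Graph_Theory"
begin

text \<open>
  A weighted digraph is given by a digraph \<open>G :: 'a pair_pre_digraph\<close>, whose arcs are ordered
  pairs of vertices, together with an edge weight function \<open>w :: 'a \<times> 'a \<Rightarrow> 'b\<close> into a field.
  Only the values of \<open>w\<close> on \<open>parcs G\<close> are meaningful.
\<close>

definition induced_weights ::
    "'a pair_pre_digraph \<Rightarrow> ('a \<times> 'a \<Rightarrow> 'b) \<Rightarrow> ('a \<Rightarrow> 'b) \<Rightarrow> bool" where
  "induced_weights G w \<omega> \<longleftrightarrow> (\<forall>(u, v) \<in> parcs G. w (u, v) = \<omega> v)"

text \<open>
  The library notion \<^const>\<open>spanning_tree\<close> requires connectedness of the underlying undirected
  graph but excludes only directed cycles (loops and antiparallel pairs of arcs included).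
  Being a tree also means that there is no undirected cycle.  Undirected cycles on at least three
  vertices are the cycles of length at least 3 of the symmetrised digraph; every edge gives
  a closed walk of length 2 there, hence the bound.
\<close>

definition oriented_spanning_tree ::
    "'a pair_pre_digraph \<Rightarrow> 'a \<Rightarrow> 'a pair_pre_digraph \<Rightarrow> bool" where
  "oriented_spanning_tree G r T \<longleftrightarrow>
     spanning_tree (with_proj T) (with_proj G) \<and>
     \<not> (\<exists>p. pre_digraph.cycle (with_proj (mk_symmetric (with_proj T))) p \<and> 3 \<le> length p) \<and>
     r \<in> pverts T \<and> out_degree (with_proj T) r = 0 \<and>
     (\<forall>v \<in> pverts T - {r}. out_degree (with_proj T) v = 1)"

definition tree_sum ::
    "'a pair_pre_digraph \<Rightarrow> ('a \<times> 'a \<Rightarrow> 'b::field) \<Rightarrow> 'a \<Rightarrow> 'b" where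
  "tree_sum G w r = (\<Sum>T \<in> {T. oriented_spanning_tree G r T}. \<Prod>e \<in> parcs T. w e)"

definition biclique :: "'a pair_pre_digraph \<Rightarrow> 'a set \<Rightarrow> 'a set \<Rightarrow> bool" where
  "biclique Q Q1 Q2 \<longleftrightarrow>
     Q1 \<noteq> {} \<and> Q2 \<noteq> {} \<and> Q1 \<inter> Q2 = {} \<and> pverts Q = Q1 \<union> Q2 \<and> parcs Q = Q1 \<times> Q2"

definition star :: "'a \<Rightarrow> 'a set \<Rightarrow> 'a set \<Rightarrow> 'a pair_pre_digraph" where
  "star c Q1 Q2 = \<lparr> pverts = {c} \<union> Q1 \<union> Q2, parcs = {(u, c) |u. u \<in> Q1} \<union> {(c, v) |v. v \<in> Q2} \<rparr>"

definition star_weight :: "'a \<Rightarrow> 'a set \<Rightarrow> ('a \<Rightarrow> 'b::field) \<Rightarrow> 'a \<times> 'a \<Rightarrow> 'b" where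
  "star_weight c Q2 \<omega> = (\<lambda>(x, y). if y = c then \<Sum>v\<in>Q2. \<omega> v else \<omega> y)"

text \<open>
  Replacing the sub-digraph \<open>Q\<close> of \<open>G\<close> by \<open>S\<close>: only the arcs of \<open>Q\<close> are deleted, its vertices stay.
\<close>

definition replace_digraph ::
    "'a pair_pre_digraph \<Rightarrow> 'a pair_pre_digraph \<Rightarrow> 'a pair_pre_digraph \<Rightarrow> 'a pair_pre_digraph" where
  "replace_digraph G Q S =
     \<lparr> pverts = pverts G \<union> pverts S, parcs = (parcs G - parcs Q) \<union> parcs S \<rparr>"

definition replace_weight ::
    "('a \<times> 'a \<Rightarrow> 'b) \<Rightarrow> 'a pair_pre_digraph \<Rightarrow> ('a \<times> 'a \<Rightarrow> 'b) \<Rightarrow> 'a \<times> 'a \<Rightarrow> 'b" where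
  "replace_weight w S wS = (\<lambda>e. if e \<in> parcs S then wS e else w e)"

end

theory Submission
  imports Defs
begin

text \<open>
  An in-tree with root \<open>r\<close> is encoded by its parent function, so \<^const>\<open>tree_sum\<close> becomes a polynomial
  in the entries of a weight matrix \<open>m\<close> that is linear in each row.  Let \<open>q\<close> be the row with entries
  \<open>\<omega> v\<close> for \<open>v \<in> Q2\<close>.  Add the centre \<open>c\<close> with row \<open>q\<close> to \<open>G\<close>: nothing points to \<open>c\<close>, so tree sums are
  multiplied by \<open>\<omega>Q\<close>.  Now replace, for one \<open>x \<in> Q1\<close> after the other, the summand \<open>q\<close> of row \<open>x\<close> by a
  single arc to \<open>c\<close> of weight \<open>\<omega>Q\<close>; this does not change the tree sum (in terms of the Laplacian, row
  \<open>c\<close> is subtracted from row \<open>x\<close>), and after all steps the digraph is \<open>G'\<close>.  The formula for the root \<open>c\<close>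
  is the Markov chain tree theorem at \<open>c\<close>, divided by \<open>\<omega>Q\<close>.
\<close>

subsection \<open>Sums over parent functions\<close>

text \<open>A walk stops once it meets \<open>r\<close>, so \<open>f r\<close> may be arbitrary: the
  same predicate serves in-trees and functional digraphs on all vertices.\<close>

definition leads_to :: "('a \<Rightarrow> 'a) \<Rightarrow> 'a \<Rightarrow> 'a \<Rightarrow> bool" where
  "leads_to f r v \<longleftrightarrow> (\<exists>n. (f ^^ n) v = r)"

lemma leads_to_refl [simp]: "leads_to f r r"
  unfolding leads_to_def by (rule exI [of _ 0]) simp

lemma leads_to_iff_step: "leads_to f r v \<longleftrightarrow> v = r \<or> leads_to f r (f v)"
proof
  assume "leads_to f r v"
  then obtain n where n: "(f ^^ n) v = r" unfolding leads_to_def by blast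
  then show "v = r \<or> leads_to f r (f v)"
    by (cases n) (auto simp: leads_to_def funpow_swap1)
next
  assume "v = r \<or> leads_to f r (f v)"
  then show "leads_to f r v"
    by (metis funpow_0 funpow_Suc_right leads_to_def o_apply)
qed

lemma leads_to_induct [consumes 1, case_names root step]:
  assumes "leads_to f r v" and "P r"
    and "\<And>v. v \<noteq> r \<Longrightarrow> leads_to f r (f v) \<Longrightarrow> P (f v) \<Longrightarrow> P v"
  shows "P v"
proof -
  obtain n where "(f ^^ n) v = r" using assms(1) unfolding leads_to_def by blast
  then show ?thesis
  proof (induction n arbitrary: v)
    case 0
    then show ?case using assms(2) by simp
  next
    case (Suc n)
    then have "(f ^^ n) (f v) = r" by (simp add: funpow_swap1)
    then show ?case
      using Suc.IH [of "f v"] assms(2,3) by (metis leads_to_def)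
  qed
qed

lemma leads_to_trans:
  assumes "leads_to f s v" and "leads_to f t s"
  shows "leads_to f t v"
  using assms by (induction rule: leads_to_induct) (auto intro: iffD2 [OF leads_to_iff_step])

text \<open>The walk stays in \<open>V\<close> until it meets \<open>r\<close>, and only the values
  at the vertices before that are read.\<close>

lemma leads_to_cong:
  assumes "\<And>v. v \<in> V - {r} \<Longrightarrow> f v = g v \<and> f v \<in> V" and "v \<in> V"
  shows "leads_to f r v \<longleftrightarrow> leads_to g r v"
proof -
  have *: "leads_to h' r v"
    if "leads_to h r v" and "\<And>v. v \<in> V - {r} \<Longrightarrow> h v = h' v \<and> h v \<in> V" for h h'
    using that(1) \<open>v \<in> V\<close>
  proof (induction rule: leads_to_induct)
    case (step v)
    then show ?case using that(2) [of v] by (subst leads_to_iff_step) auto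
  qed simp
  show ?thesis using * [of f g] * [of g f] assms by metis
qed

lemma leads_to_upd_root: "leads_to (f(r := y)) r v \<longleftrightarrow> leads_to f r v"
  by (rule leads_to_cong [of UNIV]) auto

text \<open>The fixed point \<open>x\<close> is a second root. Redirecting it to \<open>a\<close>
  attaches its whole tree at \<open>a\<close>, which joins it to the tree of \<open>r\<close>
  exactly when \<open>a\<close> lies there.\<close>

lemma leads_to_upd_fixed:
  assumes "f x = x" and "x \<noteq> r"
  shows "leads_to (f(x := a)) r v \<longleftrightarrow> leads_to f r v \<or> leads_to f x v \<and> leads_to f r a"
proof
  assume "leads_to (f(x := a)) r v"
  then show "leads_to f r v \<or> leads_to f x v \<and> leads_to f r a"
  proof (induction rule: leads_to_induct)
    case (step v)
    then show ?case
      by (cases "v = x") (auto simp: leads_to_iff_step [of f _ v])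
  qed simp
next
  have not_x: "\<not> leads_to f r x"
  proof
    assume "leads_to f r x"
    then obtain n where "(f ^^ n) x = r" unfolding leads_to_def by blast
    moreover have "(f ^^ n) x = x" by (induction n) (simp_all add: assms)
    ultimately show False using assms by simp
  qed
  have root: "leads_to (f(x := a)) r v" if "leads_to f r v" for v
    using that
  proof (induction rule: leads_to_induct)
    case (step v)
    then have "v \<noteq> x" using not_x assms by auto
    then show ?case using step by (metis fun_upd_other leads_to_iff_step)
  qed simp
  assume "leads_to f r v \<or> leads_to f x v \<and> leads_to f r a"
  then show "leads_to (f(x := a)) r v"
  proof
    assume *: "leads_to f x v \<and> leads_to f r a"
    then have "leads_to (f(x := a)) x v" by (simp add: leads_to_upd_root)
    moreover have "leads_to (f(x := a)) r x"
      using * root by (subst leads_to_iff_step) simp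
    ultimately show ?thesis by (rule leads_to_trans)
  qed (rule root)
qed

text \<open>A walk cannot leave a fixed point, so the trees of different fixed points are
  disjoint.\<close>

lemma leads_to_fixed_unique:
  assumes "f s = s" and "f t = t" and "leads_to f s v" and "leads_to f t v"
  shows "s = t"
  using assms(3,4)
proof (induction rule: leads_to_induct)
  case root
  then obtain n where "(f ^^ n) s = t" unfolding leads_to_def by blast
  moreover have "(f ^^ n) s = s" by (induction n) (simp_all add: assms)
  ultimately show ?case by simp
next
  case (step v)
  then show ?case using assms by (metis leads_to_iff_step)
qed

section \<open>Weighted sums over spanning parent functions\<close>

definition spans :: "'a set \<Rightarrow> 'a \<Rightarrow> ('a \<Rightarrow> 'a) \<Rightarrow> bool" where
  "spans V r f \<longleftrightarrow> (\<forall>v\<in>V. leads_to f r v)"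

text \<open>For \<open>r\<close> in a finite \<open>V\<close> this is, by the matrix-tree theorem,
  the principal minor at \<open>r\<close> of the Laplacian of \<open>m\<close>. Extensionality gives
  each in-tree a single summand; missing arcs are zero entries.\<close>

definition parent_sum :: "'a set \<Rightarrow> 'a \<Rightarrow> ('a \<Rightarrow> 'a \<Rightarrow> 'b::comm_ring_1) \<Rightarrow> 'b" where
  "parent_sum V r m =
     (\<Sum>f \<in> (V - {r}) \<rightarrow>\<^sub>E V. of_bool (spans V r f) * (\<Prod>x \<in> V - {r}. m x (f x)))"

lemma spans_upd_root: "spans V r (f(r := y)) \<longleftrightarrow> spans V r f"
  by (simp add: spans_def leads_to_upd_root)

lemma sum_PiE_insert:
  assumes "x \<notin> S"
  shows "(\<Sum>f \<in> insert x S \<rightarrow>\<^sub>E V. h f) = (\<Sum>a\<in>V. \<Sum>g \<in> S \<rightarrow>\<^sub>E V. h (g(x := a)))"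
proof -
  have "(\<Sum>f \<in> insert x S \<rightarrow>\<^sub>E V. h f) =
      (\<Sum>(a, g) \<in> V \<times> (S \<rightarrow>\<^sub>E V). h (g(x := a)))"
    unfolding PiE_insert_eq
    by (subst sum.reindex [OF inj_combinator [OF assms]]) (simp add: case_prod_unfold)
  then show ?thesis by (simp add: sum.cartesian_product)
qed

lemma prod_upd:
  assumes "finite S" and "x \<notin> S"
  shows "(\<Prod>y \<in> insert x S. m y ((g(x := a)) y)) = m x a * (\<Prod>y\<in>S. m y (g y))"
  using assms by (simp, intro arg_cong [of _ _ "\<lambda>z. _ * z"] prod.cong) auto

section \<open>Dependence on the rows of the weight matrix\<close>

lemma parent_sum_cong:
  assumes "\<And>x y. x \<in> V - {r} \<Longrightarrow> y \<in> V \<Longrightarrow> m x y = m' x y"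
  shows "parent_sum V r m = parent_sum V r m'"
  unfolding parent_sum_def
proof (intro sum.cong refl arg_cong [of _ _ "\<lambda>z. _ * z"] prod.cong)
  fix f x
  assume "f \<in> (V - {r}) \<rightarrow>\<^sub>E V" and "x \<in> V - {r}"
  then show "m x (f x) = m' x (f x)" using assms PiE_mem by metis
qed

text \<open>Each product contains exactly one factor from row \<open>x\<close>.\<close>

lemma parent_sum_add_row:
  assumes "finite V" and "x \<in> V - {r}"
  shows "parent_sum V r (m(x := \<lambda>y. p y + q y)) =
    parent_sum V r (m(x := p)) + parent_sum V r (m(x := q))"
proof -
  have "(\<Prod>z \<in> V - {r}. (m(x := p')) z (f z)) = p' (f x) * (\<Prod>z \<in> V - {r} - {x}. m z (f z))"
    for p' f
    using assms by (subst prod.remove [of _ x]) (auto intro!: prod.cong)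
  then show ?thesis
    unfolding parent_sum_def by (simp add: sum.distrib [symmetric] algebra_simps)
qed

text \<open>Identities in rows \<open>x\<close> and \<open>y\<close> can then be checked separately
  for each choice \<open>g\<close> of the other parents.\<close>

lemma parent_sum_expand_two:
  assumes "finite V" and "x \<in> V - {r}" and "y \<in> V - {r}" and "x \<noteq> y"
  shows "parent_sum V r m =
    (\<Sum>g \<in> (V - {r, x, y}) \<rightarrow>\<^sub>E V.
      (\<Sum>a\<in>V. \<Sum>b\<in>V. of_bool (spans V r (g(x := a, y := b))) * (m x a * m y b)) *
      (\<Prod>z \<in> V - {r, x, y}. m z (g z)))"
proof -
  let ?S = "V - {r, x, y}"
  have V: "V - {r} = insert y (insert x ?S)" using assms by auto
  have "parent_sum V r m = (\<Sum>b\<in>V. \<Sum>a\<in>V. \<Sum>g \<in> ?S \<rightarrow>\<^sub>E V.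
      of_bool (spans V r (g(x := a, y := b))) * (m y b * (m x a * (\<Prod>z\<in>?S. m z (g z)))))"
    unfolding parent_sum_def V using assms
    by (simp add: sum_PiE_insert prod_upd del: prod.insert fun_upd_apply)
  also have "\<dots> = (\<Sum>a\<in>V. \<Sum>b\<in>V. \<Sum>g \<in> ?S \<rightarrow>\<^sub>E V.
      of_bool (spans V r (g(x := a, y := b))) * (m y b * (m x a * (\<Prod>z\<in>?S. m z (g z)))))"
    by (rule sum.swap)
  also have "\<dots> = (\<Sum>g \<in> ?S \<rightarrow>\<^sub>E V. \<Sum>a\<in>V. \<Sum>b\<in>V.
      of_bool (spans V r (g(x := a, y := b))) * (m y b * (m x a * (\<Prod>z\<in>?S. m z (g z)))))"
    by (subst (2) sum.swap, subst sum.swap) (rule refl)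
  finally show ?thesis
    by (simp add: sum_distrib_left algebra_simps)
qed

text \<open>Without the arcs out of \<open>x\<close> and \<open>y\<close> there remains a forest with roots \<open>x\<close>, \<open>y\<close>, \<open>r\<close>.  The two
  sides differ only in the pairs \<open>(a, b)\<close> with \<open>a\<close> in the tree of \<open>r\<close> and \<open>b\<close> in that of \<open>x\<close>, respectively
  the other way round, and these have the same total weight.\<close>

lemma sum_spans_exchange:
  fixes q :: "'a \<Rightarrow> 'b::comm_ring_1"
  assumes "x \<noteq> r" "y \<noteq> r" "x \<noteq> y" "x \<in> V" "y \<in> V" "r \<in> V"
  shows "(\<Sum>a\<in>V. \<Sum>b\<in>V. of_bool (spans V r (g(x := a, y := b))) * (q a * q b)) =
    (\<Sum>a\<in>V. \<Sum>b\<in>V. of_bool (spans V r (g(x := y, y := b))) * (q a * q b))"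
proof -
  define h where "h = g(x := x, y := y, r := r)"
  define L where "L = leads_to h"
  have h: "h x = x" "h y = y" "h r = r" using assms by (auto simp: h_def)
  have unique: "s = t" if "L s v" "L t v" "s \<in> {x, y, r}" "t \<in> {x, y, r}" for s t v
    using leads_to_fixed_unique [of h s t v] that h unfolding L_def by auto
  \<comment> \<open>In \<open>h\<close> the roots are fixed points. \<open>y\<close> and then
    \<open>x\<close> is redirected, each still fixed at that moment, as
    \<open>leads_to_upd_fixed\<close> demands.\<close>
  have spans_iff: "spans V r (g(x := a, y := b)) \<longleftrightarrow>
      (\<forall>v\<in>V. L r v \<or> L y v \<and> L r b \<or>
        (L x v \<or> L y v \<and> L x b) \<and> (L r a \<or> L y a \<and> L r b))" for a b
  proof -
    have "(g(x := a, y := b))(r := r) = h(y := b, x := a)"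
      using assms by (auto simp: h_def)
    then have "leads_to (g(x := a, y := b)) r v \<longleftrightarrow> leads_to (h(y := b, x := a)) r v" for v
      by (metis leads_to_upd_root)
    then show ?thesis
      using assms h
      by (simp add: spans_def L_def leads_to_upd_fixed leads_to_upd_root)
  qed
  show ?thesis
  \<comment> \<open>If some vertex reaches none of the three roots, no \<open>a\<close> and
    \<open>b\<close> make the function span \<open>V\<close>, and both sides vanish.\<close>
  proof (cases "\<forall>v\<in>V. L x v \<or> L y v \<or> L r v")
    case False
    then show ?thesis unfolding spans_iff by (intro sum.cong refl) auto
  next
    case forest: True
    have self: "L x x" "L y y" "L r r" unfolding L_def by simp_all
    have left: "of_bool (spans V r (g(x := a, y := b))) =
        of_bool (L r b) * of_bool (L r a \<or> L y a) + (of_bool (L r a) * of_bool (L x b) :: 'b)"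
      if "a \<in> V" "b \<in> V" for a b
    proof -
      have "spans V r (g(x := a, y := b)) \<longleftrightarrow>
          L r b \<and> (L r a \<or> L y a) \<or> L r a \<and> L x b"
        unfolding spans_iff using forest unique self assms that by blast
      moreover have "\<not> (L r b \<and> L x b)" using unique assms by blast
      ultimately show ?thesis by auto
    qed
    \<comment> \<open>The condition here concerns only \<open>b\<close>; splitting by the tree that
      contains \<open>a\<close> exposes the first summand of \<open>left\<close>.\<close>
    have right: "of_bool (spans V r (g(x := y, y := b))) =
        of_bool (L r b) * of_bool (L r a \<or> L y a) + (of_bool (L r b) * of_bool (L x a) :: 'b)"
      if "a \<in> V" "b \<in> V" for a b
    proof -
      have "spans V r (g(x := y, y := b)) \<longleftrightarrow> L r b"
        unfolding spans_iff using forest unique self assms that by blast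
      moreover have "(L r a \<or> L y a) = (\<not> L x a)" using forest unique assms that by blast
      ultimately show ?thesis by auto
    qed
    have swap: "(\<Sum>a\<in>V. \<Sum>b\<in>V. of_bool (L r a) * of_bool (L x b) * (q a * q b)) =
        (\<Sum>a\<in>V. \<Sum>b\<in>V. of_bool (L r b) * of_bool (L x a) * (q a * q b))"
      by (subst sum.swap) (simp add: mult_ac)
    have "(\<Sum>a\<in>V. \<Sum>b\<in>V. of_bool (spans V r (g(x := a, y := b))) * (q a * q b)) =
        (\<Sum>a\<in>V. \<Sum>b\<in>V. of_bool (L r b) * of_bool (L r a \<or> L y a) * (q a * q b)) +
        (\<Sum>a\<in>V. \<Sum>b\<in>V. of_bool (L r b) * of_bool (L x a) * (q a * q b))"
      by (simp only: left distrib_right sum.distrib swap cong: sum.cong)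
    also have "\<dots> = (\<Sum>a\<in>V. \<Sum>b\<in>V.
        (of_bool (L r b) * of_bool (L r a \<or> L y a) + of_bool (L r b) * of_bool (L x a)) * (q a * q b))"
      by (simp only: distrib_right sum.distrib)
    also have "\<dots> = (\<Sum>a\<in>V. \<Sum>b\<in>V. of_bool (spans V r (g(x := y, y := b))) * (q a * q b))"
      by (rule sum.cong [OF refl], rule sum.cong [OF refl]) (simp only: right)
    finally show ?thesis .
  qed
qed

text \<open>Once \<open>sum q V\<close> is spread over an index \<open>a\<close>, both sides weight
  the pairs \<open>(a, b)\<close> by \<open>q a * q b\<close>, because row \<open>y\<close> is also
  \<open>q\<close>; \<open>sum_spans_exchange\<close> then applies for each
  \<open>g\<close>.\<close>

lemma parent_sum_exchange:
  assumes "finite V" and "x \<in> V - {r}" and "y \<in> V - {r}" and "x \<noteq> y" and "r \<in> V"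
    and "m y = q"
  shows "parent_sum V r (m(x := \<lambda>z. if z = y then sum q V else 0)) =
    parent_sum V r (m(x := q))"
proof -
  have "(\<Sum>a\<in>V. \<Sum>b\<in>V. of_bool (spans V r (g(x := a, y := b))) *
        ((if a = y then sum q V else 0) * q b)) =
      (\<Sum>a\<in>V. \<Sum>b\<in>V. of_bool (spans V r (g(x := a, y := b))) * (q a * q b))" for g
  proof -
    have "(\<Sum>a\<in>V. \<Sum>b\<in>V. of_bool (spans V r (g(x := a, y := b))) *
        ((if a = y then sum q V else 0) * q b)) =
      (\<Sum>a\<in>V. if a = y then \<Sum>b\<in>V. of_bool (spans V r (g(x := y, y := b))) * (sum q V * q b) else 0)"
      by (intro sum.cong refl) auto
    also have "\<dots> = (\<Sum>b\<in>V. of_bool (spans V r (g(x := y, y := b))) * (sum q V * q b))"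
      using assms by simp
    also have "\<dots> = (\<Sum>a\<in>V. \<Sum>b\<in>V. of_bool (spans V r (g(x := y, y := b))) * (q a * q b))"
      by (subst sum.swap) (simp add: sum_distrib_left sum_distrib_right)
    finally show ?thesis using assms by (subst sum_spans_exchange) auto
  qed
  moreover have "(\<Prod>z \<in> V - {r, x, y}. (m(x := p)) z (g z)) = (\<Prod>z \<in> V - {r, x, y}. m z (g z))"
    for p g by (intro prod.cong) auto
  moreover have "(m(x := p)) x = p" "(m(x := p)) y = q" for p using assms by auto
  ultimately show ?thesis
    by (simp only: parent_sum_expand_two [OF assms(1-4)])
qed

text \<open>The zero column makes \<open>c\<close> a leaf of every contributing in-tree, and any
  vertex of \<open>V\<close> can be its parent.\<close>

lemma parent_sum_source:
  fixes m :: "'a \<Rightarrow> 'a \<Rightarrow> 'b::comm_ring_1"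
  assumes "finite V" and "c \<notin> V" and "r \<in> V" and "\<And>x. x \<in> insert c V \<Longrightarrow> m x c = 0"
  shows "parent_sum (insert c V) r m = sum (m c) V * parent_sum V r m"
proof -
  let ?h = "\<lambda>a g. of_bool (spans (insert c V) r (g(c := a))) *
    (m c a * (\<Prod>x \<in> V - {r}. m x (g x)))"
  have V: "insert c V - {r} = insert c (V - {r})" using assms by auto
  have spans: "spans (insert c V) r (g(c := a)) \<longleftrightarrow> spans V r g"
    if "a \<in> V" and "g \<in> (V - {r}) \<rightarrow>\<^sub>E V" for a g
  proof -
    have "leads_to (g(c := a)) r v \<longleftrightarrow> leads_to g r v" if "v \<in> V" for v
    proof (rule leads_to_cong [of V])
      fix u assume "u \<in> V - {r}"
      then show "(g(c := a)) u = g u \<and> (g(c := a)) u \<in> V"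
        using \<open>g \<in> _\<close> assms(2) by (auto simp: PiE_mem)
    qed fact
    moreover have "leads_to (g(c := a)) r c \<longleftrightarrow> leads_to (g(c := a)) r a"
      using assms by (subst leads_to_iff_step) auto
    ultimately show ?thesis using \<open>a \<in> V\<close> by (auto simp: spans_def)
  qed
  have "parent_sum (insert c V) r m = (\<Sum>a\<in>insert c V. \<Sum>g \<in> (V - {r}) \<rightarrow>\<^sub>E insert c V. ?h a g)"
    unfolding parent_sum_def V using assms
    by (simp add: sum_PiE_insert prod_upd del: prod.insert fun_upd_apply sum.insert)
  \<comment> \<open>The choice \<open>a = c\<close>, and next every \<open>g\<close> that takes the
    value \<open>c\<close>, brings in a zero factor from column \<open>c\<close>.\<close>
  also have "\<dots> = (\<Sum>a\<in>V. \<Sum>g \<in> (V - {r}) \<rightarrow>\<^sub>E insert c V. ?h a g)"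
    using assms by simp
  also have "\<dots> = (\<Sum>a\<in>V. \<Sum>g \<in> (V - {r}) \<rightarrow>\<^sub>E V. ?h a g)"
  proof (rule sum.cong [OF refl], rule sum.mono_neutral_right; (intro ballI)?)
    show "finite ((V - {r}) \<rightarrow>\<^sub>E insert c V)" using assms by (intro finite_PiE) auto
    show "(V - {r}) \<rightarrow>\<^sub>E V \<subseteq> (V - {r}) \<rightarrow>\<^sub>E insert c V" by (intro PiE_mono) auto
    fix a g assume g: "g \<in> ((V - {r}) \<rightarrow>\<^sub>E insert c V) - ((V - {r}) \<rightarrow>\<^sub>E V)"
    then obtain x where "x \<in> V - {r}" "g x = c" by (auto simp: PiE_iff)
    then have "(\<Prod>x \<in> V - {r}. m x (g x)) = 0"
      using assms by (intro prod_zero) auto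
    then show "?h a g = 0" by simp
  qed
  also have "\<dots> = (\<Sum>a\<in>V. m c a * parent_sum V r m)"
    unfolding parent_sum_def
    by (simp add: spans sum_distrib_left mult_ac cong: sum.cong)
  finally show ?thesis by (simp add: sum_distrib_right)
qed

subsection \<open>The Markov chain tree theorem\<close>

text \<open>Adding an arc out of the root to an in-tree gives a functional digraph whose only cycle passes
  through the root; conversely, deleting any arc of that cycle gives an in-tree.\<close>

lemma spans_cycle_unique:
  assumes "spans V r f" and "r \<in> V" and "f \<in> V \<rightarrow> V"
  shows "\<exists>!x. x \<in> V \<and> f x = r \<and> spans V x f"
proof -
  have closed: "(f ^^ n) v \<in> V" if "v \<in> V" for n v
    using assms(3) that by (induction n) auto
  obtain n where n: "(f ^^ n) (f r) = r"
    using assms unfolding spans_def leads_to_def by auto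
  \<comment> \<open>This is the vertex just before \<open>r\<close> on the cycle.\<close>
  let ?x = "(f ^^ n) r"
  have "f ?x = r" using n by (simp add: funpow_swap1)
  moreover have "leads_to f ?x r" by (auto simp: leads_to_def)
  then have "spans V ?x f" using assms(1) leads_to_trans unfolding spans_def by metis
  moreover have "x = x'"
    if x: "x \<in> V" "f x = r" "spans V x f" and x': "x' \<in> V" "f x' = r" "spans V x' f" for x x'
  proof -
    \<comment> \<open>Both candidates are periodic. With a common period \<open>Suc N\<close>, each
      equals \<open>(f ^^ N) r\<close>, since \<open>f\<close> maps both to
      \<open>r\<close>.\<close>
    have period: "\<exists>n. (f ^^ Suc n) z = z" if z: "f z = r" "spans V z f" for z
    proof -
      obtain n where "(f ^^ n) r = z" using z assms(2) unfolding spans_def leads_to_def by auto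
      then show ?thesis using z by (intro exI [of _ n]) (simp add: funpow_Suc_right del: funpow.simps)
    qed
    obtain k k' where k: "(f ^^ Suc k) x = x" "(f ^^ Suc k') x' = x'"
      using period x x' by metis
    have iter: "(f ^^ (i * j)) z = z" if "(f ^^ j) z = z" for i j z
      using that by (induction i) (simp_all add: funpow_add)
    have "(f ^^ (Suc k' * Suc k)) x = x" "(f ^^ (Suc k' * Suc k)) x' = x'"
      using iter [OF k(1), of "Suc k'"] iter [OF k(2), of "Suc k"] by (simp_all only: mult.commute)
    moreover obtain N where "Suc k' * Suc k = Suc N" by simp
    ultimately show ?thesis
      using x(2) x'(2) by (simp add: funpow_Suc_right del: funpow.simps)
  qed
  ultimately show ?thesis using closed assms(2) by blast
qed

text \<open>Both sides are the total weight of the functions on \<open>V\<close> with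
  \<open>spans V r f\<close>. The left side splits off the value at \<open>r\<close>; the right side
  sorts them by the vertex \<open>x\<close> before \<open>r\<close> on the cycle and splits off the
  value at \<open>x\<close>.\<close>

theorem markov_chain_tree:
  fixes m :: "'a \<Rightarrow> 'a \<Rightarrow> 'b::comm_ring_1"
  assumes "finite V" and "r \<in> V"
  shows "sum (m r) V * parent_sum V r m = (\<Sum>x\<in>V. m x r * parent_sum V x m)"
proof -
  let ?W = "\<lambda>f. \<Prod>x\<in>V. m x (f x)"
  \<comment> \<open>\<open>spans V x f\<close> ignores \<open>f x\<close>, so this value is summed
    separately. \<open>P\<close> is trivial for the left side and selects \<open>r\<close> for the
    right one.\<close>
  have split: "(\<Sum>f \<in> V \<rightarrow>\<^sub>E V. of_bool (P (f x) \<and> spans V x f) * ?W f) =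
      (\<Sum>a\<in>V. of_bool (P a) * m x a) * parent_sum V x m" if "x \<in> V" for x P
  proof -
    define S where "S = V - {x}"
    have S: "x \<notin> S" "finite S" and V: "insert x S = V"
      using assms(1) that by (auto simp: S_def)
    have "(\<Sum>f \<in> insert x S \<rightarrow>\<^sub>E V. of_bool (P (f x) \<and> spans V x f) *
          (\<Prod>x \<in> insert x S. m x (f x))) =
        (\<Sum>a\<in>V. \<Sum>g \<in> S \<rightarrow>\<^sub>E V. of_bool (P a \<and> spans V x g) *
          (m x a * (\<Prod>y\<in>S. m y (g y))))"
      by (simp only: sum_PiE_insert [OF S(1)] prod_upd [OF S(2,1)] spans_upd_root fun_upd_same)
    then show ?thesis
      unfolding V
      by (simp add: parent_sum_def S_def [symmetric] sum_product of_bool_conj mult_ac)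
  qed
  have "sum (m r) V * parent_sum V r m = (\<Sum>f \<in> V \<rightarrow>\<^sub>E V. of_bool (spans V r f) * ?W f)"
    using split [OF assms(2), of "\<lambda>_. True"] by simp
  \<comment> \<open>The inner sum counts the predecessors of \<open>r\<close> on the cycle: one if
    \<open>f\<close> spans, none otherwise.\<close>
  also have "\<dots> = (\<Sum>f \<in> V \<rightarrow>\<^sub>E V. (\<Sum>x\<in>V. of_bool (f x = r \<and> spans V x f)) * ?W f)"
  proof (intro sum.cong refl arg_cong [of _ _ "\<lambda>z. z * _"])
    fix f assume "f \<in> V \<rightarrow>\<^sub>E V"
    then have f: "f \<in> V \<rightarrow> V" by auto
    show "of_bool (spans V r f) = (\<Sum>x\<in>V. of_bool (f x = r \<and> spans V x f) :: 'b)"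
    proof (cases "spans V r f")
      case True
      obtain x where x: "x \<in> V" "f x = r" "spans V x f"
        and "\<And>y. y \<in> V \<and> f y = r \<and> spans V y f \<Longrightarrow> y = x"
        using spans_cycle_unique [OF True assms(2) f] by metis
      then have "(\<Sum>y\<in>V. of_bool (f y = r \<and> spans V y f)) = (\<Sum>y\<in>V. of_bool (y = x) :: 'b)"
        by (intro sum.cong refl arg_cong [of _ _ of_bool]) blast
      then show ?thesis using True x(1) assms(1) by (simp add: of_bool_def)
    next
      case False
      have "\<not> (f x = r \<and> spans V x f)" if "x \<in> V" for x
      proof
        assume *: "f x = r \<and> spans V x f"
        then have "leads_to f r x" by (subst leads_to_iff_step) auto
        then have "spans V r f" using * leads_to_trans unfolding spans_def by metis
        then show False using False by simp
      qed
      then show ?thesis using False by (subst sum.neutral) auto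
    qed
  qed
  also have "\<dots> = (\<Sum>x\<in>V. \<Sum>f \<in> V \<rightarrow>\<^sub>E V. of_bool (f x = r \<and> spans V x f) * ?W f)"
    by (simp only: sum_distrib_right) (rule sum.swap)
  also have "\<dots> = (\<Sum>x\<in>V. m x r * parent_sum V x m)"
  proof (intro sum.cong refl)
    fix x assume x: "x \<in> V"
    have "(\<Sum>a\<in>V. of_bool (a = r) * m x a) = m x r"
      using assms by (simp add: of_bool_def if_distrib [of "\<lambda>z. z * _"] cong: if_cong)
    then show "(\<Sum>f \<in> V \<rightarrow>\<^sub>E V. of_bool (f x = r \<and> spans V x f) * ?W f) = m x r * parent_sum V x m"
      using split [OF x, of "\<lambda>a. a = r"] by simp
  qed
  finally show ?thesis .
qed

subsection \<open>Oriented spanning trees as parent functions\<close>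

text \<open>The distance to \<open>r\<close> along \<open>f\<close> is such a rank; it serves to
  exclude both directed cycles and undirected cycles of length at least 3.\<close>

lemma spans_rank:
  assumes "spans V r f"
  obtains d :: "'a \<Rightarrow> nat" where "\<And>x. x \<in> V - {r} \<Longrightarrow> d (f x) < d x"
proof
  let ?d = "\<lambda>x. LEAST n. (f ^^ n) x = r"
  fix x assume x: "x \<in> V - {r}"
  then obtain n where "(f ^^ n) x = r" using assms by (auto simp: spans_def leads_to_def)
  then have d: "(f ^^ ?d x) x = r" by (rule LeastI)
  then obtain m where m: "?d x = Suc m" using x by (cases "?d x") auto
  then have "(f ^^ m) (f x) = r" using d by (simp add: funpow_swap1)
  then have "?d (f x) \<le> m" by (rule Least_le)
  then show "?d (f x) < ?d x" using m by simp
qed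

definition parent_digraph :: "'a set \<Rightarrow> 'a \<Rightarrow> ('a \<Rightarrow> 'a) \<Rightarrow> 'a pair_pre_digraph" where
  "parent_digraph V r f = \<lparr> pverts = V, parcs = (\<lambda>x. (x, f x)) ` (V - {r}) \<rparr>"

lemma pverts_parent_digraph [simp]: "pverts (parent_digraph V r f) = V"
  by (simp add: parent_digraph_def)

lemma in_parcs_parent_digraph [simp]:
  "(x, y) \<in> parcs (parent_digraph V r f) \<longleftrightarrow> x \<in> V - {r} \<and> y = f x"
  by (auto simp: parent_digraph_def)

section \<open>Acyclicity and connectedness of the digraph of a parent function\<close>

lemma pcas_nth:
  assumes "pcas u p v" and "i < length p"
  shows "fst (p ! i) = (if i = 0 then u else snd (p ! (i - 1)))"
  using assms
proof (induction p arbitrary: u i)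
  case (Cons e p)
  then show ?case
    using Cons.IH [of "snd e" "i - 1"] by (cases i) (auto simp: nth_Cons')
qed simp

lemma pcas_last: "pcas u p v \<Longrightarrow> p \<noteq> [] \<Longrightarrow> snd (p ! (length p - 1)) = v"
  by (induction p arbitrary: u) (auto simp: nth_Cons')

text \<open>On a closed walk, a vertex of largest rank has its parent on both sides, so a cycle in the
  symmetrised digraph has length at most 2.\<close>

lemma cycle_symmetric_parent_digraph:
  fixes d :: "'a \<Rightarrow> nat"
  assumes d: "\<And>x. x \<in> V - {r} \<Longrightarrow> d (f x) < d x"
    and cyc: "pre_digraph.cycle (with_proj (mk_symmetric (with_proj (parent_digraph V r f)))) p"
  shows "length p < 3"
proof (rule ccontr)
  assume long: "\<not> length p < 3"
  let ?k = "length p" and ?S = "mk_symmetric (with_proj (parent_digraph V r f))"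
  obtain u where walk: "pcas u p u" and arcs: "set p \<subseteq> parcs ?S"
    and dist: "distinct (tl (pre_digraph.awalk_verts (with_proj ?S) u p))"
    using cyc unfolding pre_digraph.cycle_def pre_digraph.awalk_def cas_with_proj_eq by auto
  have "distinct (map snd p)"
    using dist long walk
    by (subst (asm) pre_digraph.awalk_verts_conv' [where v = u])
      (auto simp: cas_with_proj_eq split: if_splits)
  then have inj: "i = j" if "snd (p ! i) = snd (p ! j)" "i < ?k" "j < ?k" for i j
    using that by (simp add: distinct_conv_nth) metis
  \<comment> \<open>The predecessor is cyclic: the tail of arc 0 is the head of the last
    arc.\<close>
  define pred where "pred i = (if i = 0 then ?k - 1 else i - 1)" for i
  have tail: "fst (p ! i) = snd (p ! pred i)" if "i < ?k" for i
    using pcas_nth [OF walk that] pcas_last [OF walk] that unfolding pred_def by fastforce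
  have edge: "fst e \<in> V - {r} \<and> snd e = f (fst e) \<or> snd e \<in> V - {r} \<and> fst e = f (snd e)"
    if "e \<in> set p" for e
    using that arcs by (auto simp: parcs_mk_symmetric)
  have up: "snd e = f (fst e)" if "e \<in> set p" "d (snd e) \<le> d (fst e)" for e
    using edge [OF that(1)] that(2) d by fastforce
  have down: "fst e = f (snd e)" if "e \<in> set p" "d (fst e) \<le> d (snd e)" for e
    using edge [OF that(1)] that(2) d by fastforce
  \<comment> \<open>A vertex of largest rank is the head of arc \<open>i\<close> and the tail of arc
    \<open>j\<close>, so the other end of either arc is its parent.\<close>
  obtain i where i: "i < ?k" and max: "\<And>j. j < ?k \<Longrightarrow> d (snd (p ! j)) \<le> d (snd (p ! i))"
  proof -
    let ?D = "(\<lambda>j. d (snd (p ! j))) ` {..<?k}"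
    have "Max ?D \<in> ?D" using long by (intro Max_in) (auto simp: lessThan_empty_iff)
    then obtain i where "i < ?k" "d (snd (p ! i)) = Max ?D" by auto
    then show ?thesis using that [of i] by simp
  qed
  define j where "j = (if Suc i = ?k then 0 else Suc i)"
  have j: "j < ?k" "pred j = i" using i long by (auto simp: j_def pred_def)
  have pred_i: "pred i < ?k" using i by (auto simp: pred_def)
  have "fst (p ! i) = f (snd (p ! i))"
    using i pred_i max tail by (intro down) auto
  moreover have "snd (p ! j) = f (fst (p ! j))"
    using j max tail by (intro up) auto
  ultimately have "snd (p ! pred i) = snd (p ! j)" using tail i j by simp
  then have "pred i = j" using inj pred_i j by blast
  \<comment> \<open>\<open>i - 1\<close> and \<open>i + 1\<close> agree modulo the length only if
    the length is at most 2.\<close>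
  then show False using i long by (auto simp: pred_def j_def split: if_splits)
qed

text \<open>The rank drops along every nonempty directed walk, so none is closed.\<close>

lemma forest_parent_digraph:
  fixes d :: "'a \<Rightarrow> nat"
  assumes d: "\<And>x. x \<in> V - {r} \<Longrightarrow> d (f x) < d x"
    and wf: "pair_wf_digraph (parent_digraph V r f)"
  shows "forest (with_proj (parent_digraph V r f))"
  unfolding forest_def
proof
  interpret T: pair_wf_digraph "parent_digraph V r f" by (rule wf)
  assume "\<exists>p. T.cycle p"
  then obtain p u where "T.awalk u p u" "p \<noteq> []" by (auto simp: T.cycle_def)
  then have "(u, u) \<in> (parcs (parent_digraph V r f))\<^sup>+" using T.reachable1_awalk by auto
  moreover have "d y < d x" if "(x, y) \<in> (parcs (parent_digraph V r f))\<^sup>+" for x y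
    using that by induction (use d in \<open>auto intro: less_trans\<close>)
  ultimately show False by blast
qed

lemma connected_parent_digraph:
  assumes "spans V r f" and "r \<in> V" and wf: "pair_wf_digraph (parent_digraph V r f)"
  shows "connected (with_proj (parent_digraph V r f))"
proof -
  let ?T = "parent_digraph V r f"
  interpret T: pair_wf_digraph ?T by (rule wf)
  interpret S: pair_wf_digraph "mk_symmetric (with_proj ?T)" by (rule T.wellformed_mk_symmetric)
  have root: "v \<rightarrow>\<^sup>*\<^bsub>with_proj (mk_symmetric (with_proj ?T))\<^esub> r" if "v \<in> V" for v
  proof -
    have "leads_to f r v" using assms(1) that by (simp add: spans_def)
    then have "v \<in> V \<longrightarrow> v \<rightarrow>\<^sup>*\<^bsub>with_proj ?T\<^esub> r"
    proof (induction rule: leads_to_induct)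
      case root
      then show ?case by auto
    next
      case (step v)
      show ?case
      proof
        assume "v \<in> V"
        then have "(v, f v) \<in> parcs ?T" using step by simp
        moreover from this have "f v \<in> V" using T.in_arcsD2 by fastforce
        ultimately show "v \<rightarrow>\<^sup>*\<^bsub>with_proj ?T\<^esub> r"
          using step T.adj_reachable_trans by blast
      qed
    qed
    then show ?thesis using that T.reachable_mk_symmetricI by blast
  qed
  show ?thesis
  proof (rule T.connectedI)
    show "pverts ?T \<noteq> {}" using assms(2) by auto
    fix u v assume "u \<in> pverts ?T" "v \<in> pverts ?T"
    then show "u \<rightarrow>\<^sup>*\<^bsub>with_proj (mk_symmetric (with_proj ?T))\<^esub> v"
      using root symmetric_reachable [OF symmetric_mk_symmetric] S.reachable_trans
      by (metis pverts_parent_digraph)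
  qed
qed

section \<open>Bijection between oriented spanning trees and parent functions\<close>

lemma oriented_spanning_tree_parent_digraph:
  assumes "pair_wf_digraph G" and "r \<in> pverts G" and "spans (pverts G) r f"
    and arcs: "\<And>x. x \<in> pverts G - {r} \<Longrightarrow> (x, f x) \<in> parcs G"
  shows "oriented_spanning_tree G r (parent_digraph (pverts G) r f)"
proof -
  let ?T = "parent_digraph (pverts G) r f"
  interpret G: pair_wf_digraph G by fact
  have wf: "pair_wf_digraph ?T"
    using arcs G.in_arcsD2 by unfold_locales (force simp: parent_digraph_def)+
  obtain d :: "'a \<Rightarrow> nat" where d: "\<And>x. x \<in> pverts G - {r} \<Longrightarrow> d (f x) < d x"
    using spans_rank [OF assms(3)] by blast
  have "subgraph (with_proj ?T) (with_proj G)"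
    using arcs wf assms(1)
    by (intro subgraphI) (auto simp: parent_digraph_def wf_digraph_wp_iff)
  moreover have "out_arcs (with_proj ?T) r = {}"
    by (auto simp: out_arcs_def)
  moreover have "out_arcs (with_proj ?T) v = {(v, f v)}" if "v \<in> pverts G - {r}" for v
    using that by (auto simp: out_arcs_def)
  ultimately show ?thesis
    using cycle_symmetric_parent_digraph [where d = d and f = f, OF d]
      forest_parent_digraph [where d = d and f = f, OF d wf]
      connected_parent_digraph [OF assms(3,2) wf] assms(2)
    by (auto simp: oriented_spanning_tree_def spanning_tree_def tree_def spanning_def out_degree_def
        not_le [symmetric])
qed

text \<open>The outdegrees make the arcs the graph of a function on the vertices other than
  \<open>r\<close>. By finiteness and the absence of directed cycles every walk along parents ends,
  which can happen only at \<open>r\<close>.\<close>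

lemma oriented_spanning_treeE:
  assumes "pair_fin_digraph G" and "oriented_spanning_tree G r T"
  obtains f where "f \<in> (pverts G - {r}) \<rightarrow>\<^sub>E pverts G" and "spans (pverts G) r f"
    and "\<And>x. x \<in> pverts G - {r} \<Longrightarrow> (x, f x) \<in> parcs G"
    and "T = parent_digraph (pverts G) r f"
proof
  interpret G: pair_fin_digraph G by fact
  let ?V = "pverts G"
  have sub: "subgraph (with_proj T) (with_proj G)" and V: "pverts T = ?V" and r: "r \<in> ?V"
    and acyc: "\<And>p. \<not> pre_digraph.cycle (with_proj T) p"
    and out_r: "card (out_arcs (with_proj T) r) = 0"
    and out: "\<And>v. v \<in> ?V - {r} \<Longrightarrow> card (out_arcs (with_proj T) v) = 1"
    using assms(2)
    by (auto simp: oriented_spanning_tree_def spanning_tree_def tree_def forest_def spanning_def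
        out_degree_def)
  have TG: "parcs T \<subseteq> parcs G" and "wf_digraph (with_proj T)" using sub by (auto simp: subgraph_def)
  then interpret T: pair_wf_digraph T by (simp add: wf_digraph_wp_iff)
  have fin: "finite (parcs T)" using TG finite_subset G.pair_finite_arcs by blast
  define f where "f = (\<lambda>x\<in>?V - {r}. THE y. (x, y) \<in> parcs T)"
  have unique: "\<exists>!y. (x, y) \<in> parcs T" if x: "x \<in> ?V - {r}" for x
  proof -
    obtain e where "out_arcs (with_proj T) x = {e}" using out [OF x] by (meson card_1_singletonE)
    then have "\<And>e'. e' \<in> parcs T \<and> fst e' = x \<longleftrightarrow> e' = e"
      by (auto simp: out_arcs_def)
    then show ?thesis by (metis fst_conv prod.collapse snd_conv)
  qed
  have f: "(x, y) \<in> parcs T \<longleftrightarrow> y = f x" if x: "x \<in> ?V - {r}" for x y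
    using theI' [OF unique [OF x]] unique [OF x] x by (auto simp: f_def)
  \<comment> \<open>\<open>card\<close> is 0 also on infinite sets, so finiteness has to come in
    before \<open>out_r\<close> yields emptiness.\<close>
  have no_out_r: "(r, y) \<notin> parcs T" for y
  proof -
    have "finite (out_arcs (with_proj T) r)" using fin by (simp add: out_arcs_def)
    then show ?thesis using out_r by (auto simp: out_arcs_def)
  qed
  show "f \<in> (?V - {r}) \<rightarrow>\<^sub>E ?V"
  proof (rule PiE_I)
    fix x assume "x \<in> ?V - {r}"
    then show "f x \<in> ?V" using f V T.in_arcsD2 by metis
  qed (auto simp: f_def)
  show "(x, f x) \<in> parcs G" if "x \<in> ?V - {r}" for x
    using f that TG by blast
  have "parcs T = parcs (parent_digraph ?V r f)"
  proof (intro set_eqI iffI; clarify)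
    fix x y assume e: "(x, y) \<in> parcs T"
    then have "x \<in> ?V - {r}" using no_out_r T.in_arcsD1 V by auto
    then show "(x, y) \<in> parcs (parent_digraph ?V r f)" using f e by auto
  next
    fix x y assume "(x, y) \<in> parcs (parent_digraph ?V r f)"
    then show "(x, y) \<in> parcs T" using f by auto
  qed
  then show "T = parent_digraph ?V r f" using V by (simp add: pair_pre_digraph.equality)
  have "acyclic (parcs T)"
  proof (rule acyclicI, intro allI notI)
    fix x assume "(x, x) \<in> (parcs T)\<^sup>+"
    then obtain p where "T.awalk x p x" "p \<noteq> []" using T.reachable1_awalk by auto
    then have "T.closed_w p" by (auto simp: T.closed_w_def)
    then show False using T.closed_w_imp_cycle acyc by blast
  qed
  then have "wf ((parcs T)\<inverse>)" using fin by (rule finite_acyclic_wf_converse [rotated])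
  then have "v \<in> ?V \<longrightarrow> leads_to f r v" for v
  proof (induction v rule: wf_induct_rule)
    case (less v)
    show ?case
    proof (cases "v \<in> ?V - {r}")
      case True
      then have e: "(v, f v) \<in> parcs T" using f by blast
      then have "leads_to f r (f v)" using less V T.in_arcsD2 by blast
      then show ?thesis by (subst leads_to_iff_step) simp
    qed auto
  qed
  then show "spans ?V r f" by (simp add: spans_def)
qed

text \<open>Trees correspond to the spanning parent functions with all arcs in \<open>G\<close>;
  every other function fails to span or meets a zero entry.\<close>

lemma tree_sum_eq_parent_sum:
  fixes w :: "'a \<times> 'a \<Rightarrow> 'b::field"
  assumes "pair_fin_digraph G" and r: "r \<in> pverts G"
  shows "tree_sum G w r =
    parent_sum (pverts G) r (\<lambda>x y. if (x, y) \<in> parcs G then w (x, y) else 0)"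
proof -
  interpret G: pair_fin_digraph G by fact
  let ?V = "pverts G"
  let ?m = "\<lambda>x y. if (x, y) \<in> parcs G then w (x, y) else 0"
  define F where "F = {f \<in> (?V - {r}) \<rightarrow>\<^sub>E ?V.
    spans ?V r f \<and> (\<forall>x \<in> ?V - {r}. (x, f x) \<in> parcs G)}"
  have fin: "finite ?V" by simp
  have trees: "{T. oriented_spanning_tree G r T} = parent_digraph ?V r ` F"
  proof (intro set_eqI iffI)
    fix T assume "T \<in> {T. oriented_spanning_tree G r T}"
    then show "T \<in> parent_digraph ?V r ` F"
      using oriented_spanning_treeE [OF assms(1)] by (fastforce simp: F_def)
  next
    fix T assume "T \<in> parent_digraph ?V r ` F"
    then show "T \<in> {T. oriented_spanning_tree G r T}"
      using oriented_spanning_tree_parent_digraph [OF G.pair_wf_digraph_axioms r]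
      by (auto simp: F_def)
  qed
  have inj: "inj_on (parent_digraph ?V r) F"
  proof (rule inj_onI)
    fix f g assume *: "f \<in> F" "g \<in> F" and eq: "parent_digraph ?V r f = parent_digraph ?V r g"
    have "f x = g x" if "x \<in> ?V - {r}" for x
      using that eq in_parcs_parent_digraph [of x _ ?V r] by metis
    then show "f = g" using * unfolding F_def by (blast intro: PiE_ext)
  qed
  have weight: "(\<Prod>e \<in> parcs (parent_digraph ?V r f). w e) = (\<Prod>x \<in> ?V - {r}. w (x, f x))" for f
    unfolding parent_digraph_def
    by (subst pair_pre_digraph.simps, subst prod.reindex) (auto simp: inj_on_def)
  have "tree_sum G w r = (\<Sum>f\<in>F. \<Prod>x \<in> ?V - {r}. w (x, f x))"
    unfolding tree_sum_def trees by (simp add: sum.reindex [OF inj] weight)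
  also have "\<dots> = (\<Sum>f\<in>F. of_bool (spans ?V r f) * (\<Prod>x \<in> ?V - {r}. ?m x (f x)))"
  proof (rule sum.cong [OF refl])
    fix f assume "f \<in> F"
    then have "spans ?V r f" "\<And>x. x \<in> ?V - {r} \<Longrightarrow> (x, f x) \<in> parcs G"
      by (auto simp: F_def)
    then show "(\<Prod>x \<in> ?V - {r}. w (x, f x)) =
        of_bool (spans ?V r f) * (\<Prod>x \<in> ?V - {r}. ?m x (f x))"
      by (auto intro: prod.cong)
  qed
  also have "\<dots> = parent_sum ?V r ?m"
    unfolding parent_sum_def
  proof (rule sum.mono_neutral_left; (intro ballI)?)
    show "finite ((?V - {r}) \<rightarrow>\<^sub>E ?V)" using fin by (intro finite_PiE) auto
    show "F \<subseteq> (?V - {r}) \<rightarrow>\<^sub>E ?V" by (auto simp: F_def)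
    fix f assume f: "f \<in> ((?V - {r}) \<rightarrow>\<^sub>E ?V) - F"
    show "of_bool (spans ?V r f) * (\<Prod>x \<in> ?V - {r}. ?m x (f x)) = 0"
    proof (cases "spans ?V r f")
      case True
      then have "\<exists>x \<in> ?V - {r}. (x, f x) \<notin> parcs G" using f by (auto simp: F_def)
      then have "(\<Prod>x \<in> ?V - {r}. ?m x (f x)) = 0" using fin by (intro prod_zero) auto
      then show ?thesis by simp
    qed simp
  qed
  finally show ?thesis .
qed

subsection \<open>Replacing a biclique by a star\<close>

text \<open>One row of \<open>C\<close> is changed per induction step: row linearity splits off
  \<open>e x\<close>, and \<open>parent_sum_exchange\<close> trades \<open>q\<close> for the arc to
  \<open>c\<close>, whose own row stays \<open>q\<close>.\<close>

lemma parent_sum_reroute: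
  fixes e :: "'a \<Rightarrow> 'a \<Rightarrow> 'b::comm_ring_1"
  assumes "finite V" and "finite C" and "C \<subseteq> V" and "c \<in> V" and "c \<notin> C" and "r \<in> V" and "r \<noteq> c"
    and "\<And>x. x \<in> C \<Longrightarrow> m x = (\<lambda>y. e x y + q y)" and "m c = q"
  shows "parent_sum V r (\<lambda>x. if x \<in> C then \<lambda>y. e x y + (if y = c then sum q V else 0) else m x) =
    parent_sum V r m"
  using assms(2,3,5,8)
proof (induction rule: finite_induct)
  case empty
  then show ?case by simp
next
  case (insert x C)
  let ?s = "\<lambda>y. if y = c then sum q V else 0"
  let ?M = "\<lambda>C x. if x \<in> C then \<lambda>y. e x y + ?s y else m x"
  have IH: "parent_sum V r (?M C) = parent_sum V r m"
    using insert by auto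
  have new: "?M (insert x C) = (?M C)(x := \<lambda>y. e x y + ?s y)" by auto
  have old: "?M C = (?M C)(x := \<lambda>y. e x y + q y)" using insert by auto
  have "parent_sum V r (?M (insert x C)) = parent_sum V r (?M C)"
  \<comment> \<open>Row \<open>r\<close> does not enter a sum with root \<open>r\<close>.\<close>
  proof (cases "x = r")
    case True
    then show ?thesis by (intro parent_sum_cong) auto
  next
    case False
    then have x: "x \<in> V - {r}" and c: "c \<in> V - {r}" "x \<noteq> c" using insert assms by auto
    have "parent_sum V r ((?M C)(x := ?s)) = parent_sum V r ((?M C)(x := q))"
      using insert assms by (intro parent_sum_exchange x c) auto
    then show ?thesis
      unfolding new by (subst (2) old) (simp only: parent_sum_add_row [OF assms(1) x])
  qed
  then show ?case using IH by simp
qed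

theorem lemma2p4:
  fixes G Q G' :: "'a pair_pre_digraph"
    and w w' :: "'a \<times> 'a \<Rightarrow> 'b::field"
    and \<omega> :: "'a \<Rightarrow> 'b"
    and Q1 Q2 :: "'a set"
    and c :: 'a
    and \<omega>Q :: 'b
  assumes "pair_digraph G" and "pverts G \<noteq> {}"
    and "induced_weights G w \<omega>"
    and "biclique Q Q1 Q2" and "subgraph (with_proj Q) (with_proj G)"
    and "c \<notin> pverts G"
    and "G' = replace_digraph G Q (star c Q1 Q2)"
    and "w' = replace_weight w (star c Q1 Q2) (star_weight c Q2 \<omega>)"
    and "\<omega>Q = (\<Sum>v\<in>Q2. \<omega> v)" and "\<omega>Q \<noteq> 0"
  shows "(\<forall>u \<in> pverts G. tree_sum G' w' u = \<omega>Q * tree_sum G w u) \<and>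
    tree_sum G' w' c = (\<Sum>v\<in>Q1. tree_sum G' w' v) \<and>
    (\<Sum>v\<in>Q1. tree_sum G' w' v) = \<omega>Q * (\<Sum>v\<in>Q1. tree_sum G w v)"
proof -
  interpret G: pair_digraph G by fact
  let ?V = "pverts G" and ?V' = "insert c (pverts G)"
  have Q: "parcs Q = Q1 \<times> Q2" "Q1 \<inter> Q2 = {}" "Q1 \<union> Q2 \<subseteq> ?V" "Q1 \<times> Q2 \<subseteq> parcs G"
    using assms(4,5) by (auto simp: biclique_def subgraph_def)
  have fin: "finite Q1" "finite Q2" using Q(3) by (auto intro: finite_subset)
  have c: "c \<notin> Q1" "c \<notin> Q2" "\<And>x. (x, c) \<notin> parcs G" "\<And>x. (c, x) \<notin> parcs G"
    using Q(3) assms(6) G.in_arcsD1 G.in_arcsD2 by auto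
  have weight: "w (x, y) = \<omega> y" if "(x, y) \<in> parcs G" for x y
    using assms(3) that by (auto simp: induced_weights_def)
  have V': "pverts G' = ?V'"
    using Q(3) by (auto simp: assms(7) replace_digraph_def star_def)
  have arcs': "parcs G' = (parcs G - Q1 \<times> Q2) \<union> Q1 \<times> {c} \<union> {c} \<times> Q2"
    by (auto simp: assms(7) replace_digraph_def star_def Q(1))
  interpret G': pair_fin_digraph G'
    using fin Q(3) G.in_arcsD1 G.in_arcsD2 by unfold_locales (auto simp: V' arcs')

  \<comment> \<open>As weights depend only on heads, the biclique adds the same \<open>q\<close> to
    every row of \<open>Q1\<close>. \<open>m\<close> is the matrix of \<open>G\<close> enlarged by
    \<open>c\<close> with row \<open>q\<close>, and \<open>m'\<close> is the matrix of
    \<open>G'\<close>.\<close>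
  define e where "e x y = (if (x, y) \<in> parcs G - Q1 \<times> Q2 then \<omega> y else 0)" for x y
  define q where "q y = (if y \<in> Q2 then \<omega> y else 0)" for y
  define m where "m x = (if x = c then q else if x \<in> Q1 then \<lambda>y. e x y + q y else e x)" for x
  define m' where "m' x = (if x \<in> Q1 then \<lambda>y. e x y + (if y = c then sum q ?V' else 0) else m x)" for x
  have sum_q: "sum q ?V = \<omega>Q" "sum q ?V' = \<omega>Q"
  proof -
    have "sum q ?V = sum q Q2"
      using Q(3) by (intro sum.mono_neutral_right) (auto simp: q_def)
    then show "sum q ?V = \<omega>Q" by (simp add: assms(9) q_def cong: sum.cong)
    then show "sum q ?V' = \<omega>Q" using assms(6) c by (simp add: q_def)
  qed
  have G: "tree_sum G w u = parent_sum ?V u m" if "u \<in> ?V" for u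
    unfolding tree_sum_eq_parent_sum [OF G.pair_fin_digraph that]
    using Q assms(6) weight by (intro parent_sum_cong) (auto simp: m_def e_def q_def)
  have G': "tree_sum G' w' u = parent_sum ?V' u m'" if "u \<in> ?V'" for u
    unfolding tree_sum_eq_parent_sum [OF G'.pair_fin_digraph that [folded V']] V'
    using Q(2,4) c weight sum_q(2)
    by (intro parent_sum_cong)
      (auto simp: m'_def m_def e_def q_def arcs' assms(8,9) replace_weight_def star_def star_weight_def)

  have trees: "tree_sum G' w' u = \<omega>Q * tree_sum G w u" if u: "u \<in> ?V" for u
  proof -
    \<comment> \<open>First the rows of \<open>Q1\<close> are rerouted through \<open>c\<close>;
      then \<open>c\<close>, to which nothing points in \<open>m\<close>, is removed.\<close>
    have "parent_sum ?V' u m' = parent_sum ?V' u m"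
      unfolding m'_def using Q(3) c fin assms(6) u
      by (intro parent_sum_reroute) (auto simp: m_def)
    also have "\<dots> = \<omega>Q * parent_sum ?V u m"
      using c assms(6) u sum_q(1)
      by (subst parent_sum_source) (auto simp: m_def e_def q_def)
    finally show ?thesis using u by (simp add: G G')
  qed
  \<comment> \<open>In \<open>G'\<close> the arcs out of \<open>c\<close> have total weight
    \<open>\<omega>Q\<close>, and those into \<open>c\<close> come from \<open>Q1\<close> with
    weight \<open>\<omega>Q\<close> each; the common factor cancels.\<close>
  have "\<omega>Q * tree_sum G' w' c = (\<Sum>x\<in>?V'. m' x c * parent_sum ?V' x m')"
    using markov_chain_tree [of ?V' c m'] c sum_q(2) by (simp add: G' m'_def m_def)
  also have "\<dots> = (\<Sum>x\<in>Q1. m' x c * parent_sum ?V' x m')"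
    using Q(3) c by (intro sum.mono_neutral_right) (auto simp: m'_def m_def e_def q_def)
  also have "\<dots> = (\<Sum>x\<in>Q1. \<omega>Q * tree_sum G' w' x)"
    using Q(3) c sum_q(2) by (intro sum.cong) (auto simp: G' m'_def e_def)
  finally have "tree_sum G' w' c = (\<Sum>v\<in>Q1. tree_sum G' w' v)"
    using assms(10) by (simp add: sum_distrib_left [symmetric])
  moreover have "(\<Sum>v\<in>Q1. tree_sum G' w' v) = \<omega>Q * (\<Sum>v\<in>Q1. tree_sum G w v)"
    unfolding sum_distrib_left using Q(3) by (intro sum.cong trees) auto
  ultimately show ?thesis using trees by blast
qed

end
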